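(* Let $G$ be an edge-colored graph on $n$ vertices with $\delta^c(G)\geq \frac{n+1}{2}$. (i) If $n\geq 5$, then $G$ contains two rainbow triangles sharing one common edge. (ii) If $n\geq 13$, then $G$ contains two rainbow triangles sharing one common vertex.
   Context: An edge-colored graph is a simple graph $G$ with a coloring $c:E(G)\to\mathbb{N}$ of its edges (not necessarily proper). For a vertex $v$, the color degree $d^c(v)$ is the number of distinct colors appearing on edges incident with $v$, and $\delta^c(G)=\min\{d^c(v):v\in V(G)\}$. A subgraph is rainbow if all of its edges have pairwise distinct colors. *)

theory Defs
  imports Complex_Main "HOL-Library.Ramsey"
begin

text \<open>
  A finite simple graph is given by its vertex set and its set of edges, which are two-element
  sets of vertices (\<open>[V]\<^bsup>2\<^esup>\<close> is the library notation for the latter).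
  An edge coloring is a total function on sets; only its values on edges are ever used.
\<close>

definition simple_graph :: "'a set \<Rightarrow> 'a set set \<Rightarrow> bool" where
  "simple_graph V E \<longleftrightarrow> finite V \<and> E \<subseteq> [V]\<^bsup>2\<^esup>"

definition color_degree :: "'a set set \<Rightarrow> ('a set \<Rightarrow> nat) \<Rightarrow> 'a \<Rightarrow> nat" where
  "color_degree E c v = card (c ` {e \<in> E. v \<in> e})"

text \<open>Meaningful for finite nonempty vertex sets only.\<close>

definition min_color_degree :: "'a set \<Rightarrow> 'a set set \<Rightarrow> ('a set \<Rightarrow> nat) \<Rightarrow> nat" where
  "min_color_degree V E c = Min (color_degree E c ` V)"

text \<open>A subgraph enters only through its set of edges.\<close>

definition rainbow :: "('a set \<Rightarrow> nat) \<Rightarrow> 'a set set \<Rightarrow> bool" where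
  "rainbow c F \<longleftrightarrow> inj_on c F"

text \<open>A triangle subgraph is identified with its vertex set; its edge set is \<open>[T]\<^bsup>2\<^esup>\<close>.\<close>

definition triangle :: "'a set \<Rightarrow> 'a set set \<Rightarrow> 'a set \<Rightarrow> bool" where
  "triangle V E T \<longleftrightarrow> T \<in> [V]\<^bsup>3\<^esup> \<and> [T]\<^bsup>2\<^esup> \<subseteq> E"

definition rainbow_triangle ::
  "'a set \<Rightarrow> 'a set set \<Rightarrow> ('a set \<Rightarrow> nat) \<Rightarrow> 'a set \<Rightarrow> bool" where
  "rainbow_triangle V E c T \<longleftrightarrow> triangle V E T \<and> rainbow c ([T]\<^bsup>2\<^esup>)"

end

theory Submission
  imports Defs
begin

text \<open>
  Delete edges as long as all color degrees stay at least \<open>(n + 1) / 2\<close>; then every color class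
  is a disjoint union of stars. Let \<open>m\<close> be the largest number of edges of one color at one vertex
  and let \<open>v\<close> attain it. For a neighbor \<open>y\<close> of \<open>v\<close>, the degree condition yields at least
  \<open>1 + \<Sum>(k - 1)\<close> common neighbors \<open>x\<close> with \<open>c(vy) \<noteq> c(vx), c(yx)\<close>, the sum running over the sizes
  \<open>k\<close> of the other color classes at \<open>v\<close>; in particular at least \<open>m\<close> of them if \<open>vy\<close> is alone in its
  color at \<open>v\<close>. The triangle \<open>vyx\<close> fails to be rainbow only if \<open>x\<close> is the center of a star containing
  \<open>v\<close> and \<open>y\<close>, so a given \<open>x\<close> is bad for at most \<open>m - 1\<close> choices of \<open>y\<close>. If every \<open>y\<close> is in at
  most one rainbow triangle with \<open>v\<close>, these estimates are all equalities: every \<open>x\<close> alone in its color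
  at \<open>v\<close> is the center of a star of size \<open>m\<close> whose leaves besides \<open>v\<close> are again alone in their colors
  at \<open>v\<close>. Applying this at \<open>v\<close> and then at such a leaf is contradictory if \<open>m \<ge> 2\<close>, and \<open>m = 1\<close> is
  a direct count.

  For triangles sharing only a vertex, suppose that there are none. The rainbow triangles at \<open>v\<close>
  form a graph on its neighbors without two disjoint edges and, as \<open>n \<ge> 13\<close>, with too many edges to be
  a triangle. So it is a star with some center \<open>w\<close>, and the equality argument applies to the
  neighbors of \<open>v\<close> other than \<open>w\<close>.
\<close>

text \<open>\<open>stars\<close> says that no edge meets further edges of its own color at both
  ends. As \<open>a = b\<close> is allowed, this excludes monochromatic triangles too, so each color
  forms disjoint stars.\<close>

locale star_colored_graph =
  fixes V :: "'a set" and adj :: "'a \<Rightarrow> 'a \<Rightarrow> bool" and col :: "'a \<Rightarrow> 'a \<Rightarrow> nat" and m :: nat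
  assumes finite_V: "finite V"
    and adj_in_V: "adj u v \<Longrightarrow> u \<in> V"
    and adj_irrefl: "\<not> adj u u"
    and adj_sym: "adj u v \<Longrightarrow> adj v u"
    and col_sym: "col u v = col v u"
    and color_deg: "v \<in> V \<Longrightarrow> card V + 1 \<le> 2 * card (col v ` Collect (adj v))"
    and stars: "\<lbrakk>adj u v; adj u a; a \<noteq> v; col u a = col u v; adj v b; b \<noteq> u\<rbrakk> \<Longrightarrow> col v b \<noteq> col u v"
    and mono_degree_le: "adj v y \<Longrightarrow> card {u. adj v u \<and> col v u = col v y} \<le> m"
    and mono_degree_attained: "\<exists>v y. adj v y \<and> card {u. adj v u \<and> col v u = col v y} = m"
begin

section \<open>Neighborhoods, color classes and apexes\<close>

definition nbrs :: "'a \<Rightarrow> 'a set" where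
  "nbrs v = {u. adj v u}"

definition color_class :: "'a \<Rightarrow> 'a \<Rightarrow> 'a set" where
  "color_class v y = {u. adj v u \<and> col v u = col v y}"

definition solo_nbrs :: "'a \<Rightarrow> 'a set" where
  "solo_nbrs v = {y \<in> nbrs v. color_class v y = {y}}"

text \<open>Both edges at \<open>x\<close> avoid the color of \<open>vy\<close>, so the triangle can
  fail to be rainbow only if these two edges agree in color.\<close>

definition apexes :: "'a \<Rightarrow> 'a \<Rightarrow> 'a set" where
  "apexes v y = {x. adj v y \<and> adj v x \<and> adj y x \<and> col y x \<noteq> col v y \<and> col v x \<noteq> col v y}"

definition bad_apexes :: "'a \<Rightarrow> 'a \<Rightarrow> 'a set" where
  "bad_apexes v y = {x \<in> apexes v y. col y x = col v x}"

definition rainbow_apexes :: "'a \<Rightarrow> 'a \<Rightarrow> 'a set" where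
  "rainbow_apexes v y = {x \<in> apexes v y. col y x \<noteq> col v x}"

definition top_vertex :: "'a \<Rightarrow> bool" where
  "top_vertex v \<longleftrightarrow> (\<exists>z\<in>nbrs v. card (color_class v z) = m)"

lemma nbrs_subset: "nbrs v \<subseteq> V"
  using adj_in_V adj_sym by (auto simp: nbrs_def)

lemma finite_nbrs [simp]: "finite (nbrs v)"
  using nbrs_subset finite_V finite_subset by blast

lemma color_class_subset: "color_class v y \<subseteq> nbrs v"
  by (auto simp: color_class_def nbrs_def)

lemma apexes_subset: "apexes v y \<subseteq> nbrs v"
  by (auto simp: apexes_def nbrs_def)

lemma finite_color_class [simp]: "finite (color_class v y)"
  using color_class_subset finite_nbrs finite_subset by blast

lemma finite_apexes [simp]: "finite (apexes v y)"
  using apexes_subset finite_nbrs finite_subset by blast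

lemma finite_solo_nbrs [simp]: "finite (solo_nbrs v)"
  by (simp add: solo_nbrs_def)

lemma finite_bad_apexes [simp]: "finite (bad_apexes v y)"
  by (simp add: bad_apexes_def)

lemma finite_rainbow_apexes [simp]: "finite (rainbow_apexes v y)"
  by (simp add: rainbow_apexes_def)

section \<open>Counting apexes from the color degrees\<close>

lemma card_apexes: "card (apexes v y) = card (bad_apexes v y) + card (rainbow_apexes v y)"
proof -
  have "apexes v y = bad_apexes v y \<union> rainbow_apexes v y" "bad_apexes v y \<inter> rainbow_apexes v y = {}"
    by (auto simp: bad_apexes_def rainbow_apexes_def)
  then show ?thesis
    by (simp add: card_Un_disjoint)
qed

lemma rainbow_apexes_commute: "rainbow_apexes v y = rainbow_apexes y v"
  using adj_sym col_sym by (auto simp: rainbow_apexes_def apexes_def)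

lemma rainbow_apexes_rotate: "x \<in> rainbow_apexes v y \<Longrightarrow> y \<in> rainbow_apexes v x"
  using adj_sym col_sym by (auto simp: rainbow_apexes_def apexes_def)

lemma self_in_color_class: "y \<in> nbrs v \<Longrightarrow> y \<in> color_class v y"
  by (simp add: color_class_def nbrs_def)

lemma card_color_class_le: "y \<in> nbrs v \<Longrightarrow> card (color_class v y) \<le> m"
  using mono_degree_le by (simp add: color_class_def nbrs_def)

text \<open>A color at \<open>y\<close> other than \<open>col v y\<close> occurs on an edge from
  \<open>y\<close> to an apex, to another member of the class of \<open>y\<close> at
  \<open>v\<close>, or to a non-neighbor of \<open>v\<close>.\<close>

lemma card_apexes_add_card_color_class:
  assumes "y \<in> nbrs v"
  shows "card (col y ` nbrs y) + card (nbrs v) + 1 \<le> card (apexes v y) + card (color_class v y) + card V"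
proof -
  have y: "adj v y" "adj y v" "y \<in> V" "v \<in> V" "y \<noteq> v"
    using assms adj_sym adj_in_V adj_irrefl by (auto simp: nbrs_def)
  let ?R = "V - insert v (nbrs v)"
  let ?U = "apexes v y \<union> (color_class v y - {y}) \<union> ?R"
  have "col y ` nbrs y - {col v y} \<subseteq> col y ` ?U"
  proof
    fix i assume "i \<in> col y ` nbrs y - {col v y}"
    then obtain x where x: "adj y x" "i = col y x" "i \<noteq> col v y"
      by (auto simp: nbrs_def)
    then have "x \<noteq> y" "x \<noteq> v" "x \<in> V"
      using adj_irrefl adj_in_V adj_sym col_sym by metis+
    with x y have "x \<in> ?U"
      by (auto simp: apexes_def color_class_def nbrs_def)
    with x show "i \<in> col y ` ?U" by blast
  qed
  then have "card (col y ` nbrs y - {col v y}) \<le> card (col y ` ?U)"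
    using finite_V by (intro card_mono) auto
  also have "\<dots> \<le> card ?U"
    using finite_V by (intro card_image_le) auto
  also have "\<dots> \<le> card (apexes v y) + card (color_class v y - {y}) + card ?R"
    by (meson add_le_mono card_Un_le le_refl order_trans)
  finally have 1: "card (col y ` nbrs y - {col v y}) \<le> card (apexes v y) + card (color_class v y - {y}) + card ?R" .
  have "col v y \<in> col y ` nbrs y"
    using y col_sym by (auto simp: nbrs_def)
  then have 2: "card (col y ` nbrs y - {col v y}) + 1 = card (col y ` nbrs y)"
    using card_Suc_Diff1[of "col y ` nbrs y" "col v y"] by simp
  have 3: "card (color_class v y - {y}) + 1 = card (color_class v y)"
    using card_Suc_Diff1[OF finite_color_class self_in_color_class[OF assms]] by simp
  have "insert v (nbrs v) \<subseteq> V"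
    using nbrs_subset y by auto
  moreover have "v \<notin> nbrs v"
    using adj_irrefl by (simp add: nbrs_def)
  ultimately have "card ?R = card V - (card (nbrs v) + 1)" "card (nbrs v) + 1 \<le> card V"
    using finite_V card_mono[of V "insert v (nbrs v)"] by (auto simp: card_Diff_subset finite_subset)
  with 1 2 3 show ?thesis by linarith
qed

lemma color_deg_nbrs: "v \<in> V \<Longrightarrow> card V + 1 \<le> 2 * card (col v ` nbrs v)"
  using color_deg by (simp add: nbrs_def)

lemma color_degrees_adj:
  assumes "y \<in> nbrs v"
  shows "card V + 1 \<le> card (col v ` nbrs v) + card (col y ` nbrs y)"
proof -
  have "y \<in> V" "v \<in> V"
    using assms nbrs_subset adj_in_V by (auto simp: nbrs_def)
  then show ?thesis
    using color_deg_nbrs[of y] color_deg_nbrs[of v] by linarith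
qed

text \<open>The neighbors of \<open>v\<close> outside the class of \<open>y\<close> carry all but
  one of the colors at \<open>v\<close>. This bounds the degree of \<open>v\<close> from below in
  the previous count.\<close>

lemma card_apexes_pos:
  assumes "y \<in> nbrs v"
  shows "1 \<le> card (apexes v y)"
proof -
  have "col v ` nbrs v \<subseteq> insert (col v y) (col v ` (nbrs v - color_class v y))"
    by (auto simp: color_class_def nbrs_def)
  then have "card (col v ` nbrs v) \<le> card (insert (col v y) (col v ` (nbrs v - color_class v y)))"
    by (intro card_mono) auto
  also have "\<dots> \<le> 1 + card (col v ` (nbrs v - color_class v y))"
    by (simp add: card_insert_le_m1 card_insert_if)
  also have "\<dots> \<le> 1 + card (nbrs v - color_class v y)"
    by (simp add: card_image_le)
  also have "\<dots> = 1 + (card (nbrs v) - card (color_class v y))"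
    by (simp add: card_Diff_subset color_class_subset)
  finally have "card (col v ` nbrs v) \<le> 1 + (card (nbrs v) - card (color_class v y))" .
  moreover have "card (color_class v y) \<le> card (nbrs v)"
    by (simp add: card_mono color_class_subset)
  ultimately show ?thesis
    using card_apexes_add_card_color_class[OF assms] color_degrees_adj[OF assms] by linarith
qed

text \<open>Collapsing two color classes at \<open>v\<close> instead of one gains the size of the
  second class.\<close>

lemma card_apexes_ge_other_class:
  assumes "y \<in> nbrs v" "z \<in> nbrs v" "z \<notin> color_class v y"
  shows "card (color_class v z) \<le> card (apexes v y)"
proof -
  let ?U = "color_class v y \<union> color_class v z"
  have U: "?U \<subseteq> nbrs v" using color_class_subset by auto
  have disj: "color_class v y \<inter> color_class v z = {}"
    using assms by (auto simp: color_class_def nbrs_def)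
  have "col v ` nbrs v \<subseteq> {col v y, col v z} \<union> col v ` (nbrs v - ?U)"
    by (auto simp: color_class_def nbrs_def)
  then have "card (col v ` nbrs v) \<le> card ({col v y, col v z} \<union> col v ` (nbrs v - ?U))"
    by (intro card_mono) auto
  also have "\<dots> \<le> card {col v y, col v z} + card (col v ` (nbrs v - ?U))"
    by (rule card_Un_le)
  also have "\<dots> \<le> 2 + card (nbrs v - ?U)"
    by (intro add_mono card_image_le) (auto simp: card_insert_if)
  also have "\<dots> = 2 + (card (nbrs v) - card ?U)"
    by (subst card_Diff_subset) (use U in auto)
  finally have "card (col v ` nbrs v) \<le> 2 + (card (nbrs v) - card ?U)" .
  moreover have "card ?U \<le> card (nbrs v)"
    using U by (simp add: card_mono)
  moreover have "card ?U = card (color_class v y) + card (color_class v z)"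
    using disj by (simp add: card_Un_disjoint)
  ultimately show ?thesis
    using card_apexes_add_card_color_class[OF assms(1)] color_degrees_adj[OF assms(1)] by linarith
qed

lemma card_apexes_ge_top:
  assumes "top_vertex v" "y \<in> solo_nbrs v"
  shows "m \<le> card (apexes v y)"
proof -
  obtain z where z: "z \<in> nbrs v" "card (color_class v z) = m"
    using assms by (auto simp: top_vertex_def)
  have y: "y \<in> nbrs v" "color_class v y = {y}" using assms by (auto simp: solo_nbrs_def)
  show ?thesis
  proof (cases "z \<in> color_class v y")
    case True
    then have "m = 1" using y z by simp
    then show ?thesis using card_apexes_pos y by simp
  next
    case False
    then show ?thesis using card_apexes_ge_other_class y z by fastforce
  qed
qed

section \<open>Double counting of bad apexes\<close>

lemma bad_apexes_imp:
  assumes "x \<in> bad_apexes v y"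
  shows "x \<in> solo_nbrs v" "y \<in> color_class x v - {v}"
proof -
  have *: "adj v y" "adj v x" "adj y x" "col y x = col v x" "y \<noteq> v"
    using assms adj_irrefl by (auto simp: bad_apexes_def apexes_def)
  \<comment> \<open>\<open>x\<close> is the center of a star with leaves \<open>v\<close> and
    \<open>y\<close>, and a leaf has no second edge of that color.\<close>
  have "u = x" if "adj v u" "col v u = col v x" for u
    using stars[of x v y u] that * adj_sym col_sym by metis
  then show "x \<in> solo_nbrs v"
    using * by (auto simp: solo_nbrs_def color_class_def nbrs_def)
  show "y \<in> color_class x v - {v}"
    using * adj_sym col_sym by (auto simp: color_class_def)
qed

lemma card_bad_apexes_fiber_le:
  assumes "x \<in> nbrs v"
  shows "card {y \<in> Y. x \<in> bad_apexes v y} \<le> card (color_class x v) - 1" and "card (color_class x v) - 1 \<le> m - 1"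
proof -
  have v: "v \<in> nbrs x" using assms adj_sym by (simp add: nbrs_def)
  have "card {y \<in> Y. x \<in> bad_apexes v y} \<le> card (color_class x v - {v})"
    using bad_apexes_imp(2) by (intro card_mono finite_Diff finite_color_class) blast
  then show "card {y \<in> Y. x \<in> bad_apexes v y} \<le> card (color_class x v) - 1"
    using self_in_color_class[OF v] by simp
  show "card (color_class x v) - 1 \<le> m - 1"
    using card_color_class_le[OF v] by simp
qed

lemma sum_card_bad_apexes:
  assumes "Y \<subseteq> nbrs v"
  shows "(\<Sum>y\<in>Y. card (bad_apexes v y \<inter> Y)) = (\<Sum>x\<in>solo_nbrs v \<inter> Y. card {y \<in> Y. x \<in> bad_apexes v y})"
proof -
  have fin: "finite Y" using assms finite_nbrs finite_subset by blast
  have "(\<Sum>y\<in>Y. card (bad_apexes v y \<inter> Y)) = (\<Sum>y\<in>Y. card {x \<in> solo_nbrs v \<inter> Y. x \<in> bad_apexes v y})"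
    by (intro sum.cong refl arg_cong[of _ _ card]) (use bad_apexes_imp(1) in auto)
  also have "\<dots> = (\<Sum>x\<in>solo_nbrs v \<inter> Y. card {y \<in> Y. x \<in> bad_apexes v y})"
    using fin by (intro sum_multicount_gen) auto
  finally show ?thesis .
qed


text \<open>A bad apex \<open>x\<close> serves only leaves other than \<open>v\<close> of its star
  through \<open>v\<close>, so at most \<open>m - 1\<close> vertices \<open>y\<close>.\<close>

lemma sum_card_bad_apexes_le:
  assumes "Y \<subseteq> nbrs v"
  shows "(\<Sum>y\<in>Y. card (bad_apexes v y \<inter> Y)) \<le> card (solo_nbrs v \<inter> Y) * (m - 1)"
proof -
  have "(\<Sum>x\<in>solo_nbrs v \<inter> Y. card {y \<in> Y. x \<in> bad_apexes v y}) \<le> (\<Sum>x\<in>solo_nbrs v \<inter> Y. m - 1)"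
    using card_bad_apexes_fiber_le assms by (intro sum_mono) (meson IntD2 order_trans subsetD)
  then show ?thesis
    using sum_card_bad_apexes[OF assms] by simp
qed

text \<open>The hypothesis of the equality argument; \<open>Y\<close> is all of \<open>nbrs v\<close> or omits one vertex.\<close>

definition tight :: "'a \<Rightarrow> 'a set \<Rightarrow> bool" where
  "tight v Y \<longleftrightarrow> top_vertex v \<and> Y \<subseteq> nbrs v \<and> (\<forall>y\<in>Y. card (apexes v y) \<le> card (bad_apexes v y \<inter> Y) + 1)"

text \<open>Each solo neighbor in \<open>Y\<close> has at least \<open>m\<close> apexes, hence at
  least \<open>m - 1\<close> bad ones in \<open>Y\<close>. These alone exhaust the upper bound of
  the double count, so nothing is left for the other \<open>y\<close> and every fiber is
  full.\<close>

lemma tight_equality: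
  assumes "tight v Y"
  shows "x \<in> solo_nbrs v \<inter> Y \<Longrightarrow> card {y \<in> Y. x \<in> bad_apexes v y} = m - 1"
    and "y \<in> Y - solo_nbrs v \<Longrightarrow> bad_apexes v y \<inter> Y = {}"
proof -
  have Y: "top_vertex v" "Y \<subseteq> nbrs v" "\<And>y. y \<in> Y \<Longrightarrow> card (apexes v y) \<le> card (bad_apexes v y \<inter> Y) + 1"
    using assms by (auto simp: tight_def)
  have fin: "finite Y" using Y finite_nbrs finite_subset by blast
  let ?b = "solo_nbrs v \<inter> Y"
  let ?f = "\<lambda>y. card (bad_apexes v y \<inter> Y)" and ?g = "\<lambda>x. card {y \<in> Y. x \<in> bad_apexes v y}"
  have split: "sum ?f Y = sum ?f ?b + sum ?f (Y - ?b)"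
    using fin sum.subset_diff[of ?b Y ?f] by simp
  have "m - 1 \<le> ?f y" if "y \<in> ?b" for y
    using that Y(3)[of y] card_apexes_ge_top[OF Y(1), of y] by force
  then have "(\<Sum>y\<in>?b. m - 1) \<le> sum ?f ?b"
    by (intro sum_mono) auto
  then have low: "card ?b * (m - 1) \<le> sum ?f ?b" by simp
  have up: "sum ?f Y \<le> card ?b * (m - 1)"
    using sum_card_bad_apexes_le[OF Y(2)] .
  have "sum ?f (Y - ?b) = 0"
    using low up split by linarith
  then show "bad_apexes v y \<inter> Y = {}" if "y \<in> Y - solo_nbrs v"
    using that fin by auto
  have g_le: "?g x \<le> m - 1" if "x \<in> ?b" for x
    using card_bad_apexes_fiber_le[of x v] that Y(2) by (meson IntD2 order_trans subsetD)
  have "sum ?g ?b = (\<Sum>x\<in>?b. m - 1)"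
    using low up split sum_card_bad_apexes[OF Y(2)] by simp
  then show "?g x = m - 1" if "x \<in> ?b"
    using sum_mono_inv[of ?g ?b "\<lambda>_. m - 1" x] g_le that fin by auto
qed

text \<open>The fiber of \<open>x\<close> is full, so it is the whole star at \<open>x\<close>
  without \<open>v\<close>. Each of its members has the bad apex \<open>x\<close> in
  \<open>Y\<close>, hence is solo.\<close>

lemma tight_single:
  assumes "tight v Y" "x \<in> solo_nbrs v \<inter> Y"
  shows "card (color_class x v) = m" and "color_class x v - {v} \<subseteq> solo_nbrs v \<inter> Y" and "top_vertex x"
proof -
  have x: "x \<in> nbrs v" and v: "v \<in> nbrs x"
    using assms adj_sym by (auto simp: solo_nbrs_def nbrs_def)
  let ?F = "{y \<in> Y. x \<in> bad_apexes v y}"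
  have F: "card ?F = m - 1" using tight_equality assms by blast
  have pos: "0 < card (color_class x v)" "card (color_class x v) \<le> m"
    using card_color_class_le[OF v] self_in_color_class[OF v] finite_color_class card_gt_0_iff by blast+
  then show card: "card (color_class x v) = m"
    using F card_bad_apexes_fiber_le(1)[OF x, of Y] by linarith
  then show "top_vertex x"
    using v by (auto simp: top_vertex_def)
  have "?F \<subseteq> color_class x v - {v}" using bad_apexes_imp(2) by blast
  moreover have "card ?F = card (color_class x v - {v})"
    using F card self_in_color_class[OF v] by simp
  ultimately have "?F = color_class x v - {v}"
    by (intro card_subset_eq) auto
  then show "color_class x v - {v} \<subseteq> solo_nbrs v \<inter> Y"
    using tight_equality(2)[OF assms(1)] assms(2) by blast
qed

text \<open>Such a \<open>y\<close> has no bad apex in \<open>Y\<close>, so at most one apex, and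
  the number of apexes bounds every other class at \<open>v\<close>.\<close>

lemma tight_multi:
  assumes "tight v Y" "y \<in> Y - solo_nbrs v"
  shows "nbrs v - color_class v y \<subseteq> solo_nbrs v"
proof
  fix z assume z: "z \<in> nbrs v - color_class v y"
  have "card (apexes v y) \<le> 1" "y \<in> nbrs v"
    using assms tight_equality(2)[OF assms] by (auto simp: tight_def)
  with z have "card (color_class v z) \<le> 1"
    using card_apexes_ge_other_class[of y v z] by auto
  with z self_in_color_class[of z v] have "color_class v z = {z}"
    using card_le_Suc0_iff_eq[OF finite_color_class, of v z] by auto
  with z show "z \<in> solo_nbrs v" by (simp add: solo_nbrs_def)
qed

text \<open>\<open>v\<close> and \<open>y\<close> are leaves of one star at \<open>x\<close>. Seen
  from \<open>v\<close>, the vertex \<open>y\<close> is solo, so its class at \<open>v\<close> has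
  size 1. Seen from \<open>y\<close>, the vertex \<open>v\<close> is solo in \<open>Y'\<close>, so
  that class has size \<open>m\<close>, which is at least 2.\<close>

lemma tight_no_return:
  assumes "tight v Y" "tight y Y'" "x \<in> solo_nbrs v \<inter> Y" "y \<in> color_class x v - {v}" "x \<in> Y'"
  shows False
proof -
  have x: "adj v x" "adj x v" and y: "adj x y" "adj y x" "col x y = col x v" "y \<noteq> v"
    using assms adj_sym by (auto simp: solo_nbrs_def nbrs_def color_class_def)
  have vS: "v \<in> color_class x y - {y}" using x y by (auto simp: color_class_def)
  have "u = x" if "adj y u" "col y u = col y x" for u
    using stars[of x y v u] that x y col_sym by metis
  then have "x \<in> solo_nbrs y"
    using y by (auto simp: solo_nbrs_def nbrs_def color_class_def)
  then have "v \<in> solo_nbrs y \<inter> Y'"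
    using tight_single(2)[OF assms(2)] assms(5) vS by blast
  then have "card (color_class v y) = m"
    using tight_single(1)[OF assms(2)] by blast
  moreover have "y \<in> solo_nbrs v"
    using tight_single(2)[OF assms(1,3)] assms(4) by blast
  then have "card (color_class v y) = 1" by (simp add: solo_nbrs_def)
  moreover have "card {v, y} \<le> card (color_class x v)"
    using assms(4) x self_in_color_class[of v x] by (intro card_mono) (auto simp: nbrs_def)
  then have "2 \<le> m"
    using tight_single(1)[OF assms(1,3)] y by simp
  ultimately show False by simp
qed

section \<open>Two rainbow triangles sharing an edge\<close>

lemma top_vertex_in_V: "top_vertex v \<Longrightarrow> v \<in> V"
  using adj_in_V by (auto simp: top_vertex_def nbrs_def)

lemma top_vertex_exists: "\<exists>v. top_vertex v"
  using mono_degree_attained by (auto simp: top_vertex_def nbrs_def color_class_def)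

text \<open>Used contrapositively, to find a neighbor of \<open>v\<close> outside a given class and
  a small set \<open>X\<close>.\<close>

lemma color_class_cover:
  assumes "v \<in> V" "nbrs v \<subseteq> color_class v y \<union> X" "finite X"
  shows "card V + 1 \<le> 2 * (1 + card X)"
proof -
  have "col v ` nbrs v \<subseteq> insert (col v y) (col v ` X)"
    using assms(2) by (auto simp: color_class_def)
  then have "card (col v ` nbrs v) \<le> card (insert (col v y) (col v ` X))"
    using assms(3) by (intro card_mono) auto
  also have "\<dots> \<le> 1 + card (col v ` X)"
    using assms(3) by (simp add: card_insert_if)
  also have "\<dots> \<le> 1 + card X"
    using assms(3) by (simp add: card_image_le)
  finally have "card (col v ` nbrs v) \<le> 1 + card X" .
  then have "2 * card (col v ` nbrs v) \<le> 2 * (1 + card X)" by simp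
  then show ?thesis using color_deg_nbrs[OF assms(1)] by (rule order_trans[rotated])
qed

text \<open>The coloring is proper, so every common neighbor is a rainbow apex and each edge lies in
  exactly one triangle. In a triangle \<open>vyz\<close>, both \<open>y\<close> and \<open>z\<close>
  turn out adjacent to every non-neighbor of \<open>v\<close>, which puts \<open>yz\<close> in a
  second triangle.\<close>

lemma proper_case:
  assumes "5 \<le> card V" and few: "\<And>v y. card (rainbow_apexes v y) \<le> 1" and "m \<le> 1"
  shows False
proof -
  have S1: "color_class v y = {y}" if "y \<in> nbrs v" for v y
    using card_color_class_le[OF that] self_in_color_class[OF that] \<open>m \<le> 1\<close> card_le_Suc0_iff_eq[OF finite_color_class, of v y]
    by auto
  have inj: "inj_on (col v) (nbrs v)" for v
  proof (rule inj_onI)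
    fix x y assume "x \<in> nbrs v" "y \<in> nbrs v" "col v x = col v y"
    then show "x = y" using S1[of y v] by (auto simp: color_class_def nbrs_def)
  qed
  have P_eq: "apexes v y = nbrs v \<inter> nbrs y" if "y \<in> nbrs v" for v y
  proof -
    have "col y x \<noteq> col v y \<and> col v x \<noteq> col v y" if x: "x \<in> nbrs v \<inter> nbrs y" for x
    proof -
      have "v \<in> nbrs y" "x \<noteq> v" "x \<noteq> y"
        using x \<open>y \<in> nbrs v\<close> adj_sym adj_irrefl by (auto simp: nbrs_def)
      then show ?thesis
        using inj_onD[OF inj, of y x v] inj_onD[OF inj, of v x y] x \<open>y \<in> nbrs v\<close> col_sym[of v y] by auto
    qed
    then show ?thesis using that by (auto simp: apexes_def nbrs_def)
  qed
  have P1: "card (apexes v y) = 1" if y: "y \<in> nbrs v" for v y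
  proof -
    have "bad_apexes v y = {}"
    proof (rule ccontr)
      assume "bad_apexes v y \<noteq> {}"
      then obtain x where x: "x \<in> bad_apexes v y" by blast
      then have "v \<in> nbrs x" using adj_sym by (auto simp: bad_apexes_def apexes_def nbrs_def)
      then show False using bad_apexes_imp(2)[OF x] S1[of v x] by auto
    qed
    then have "card (apexes v y) = card (rainbow_apexes v y)" using card_apexes[of v y] by simp
    then show ?thesis using few[of v y] card_apexes_pos[OF y] by simp
  qed
  have degN: "2 * card (nbrs v) \<ge> card V + 1" if "v \<in> V" for v
    using color_deg_nbrs[OF that] inj[of v] by (simp add: card_image)
  have deg_sum: "card (nbrs y) + card (nbrs v) \<le> card V + 1" if "y \<in> nbrs v" for v y
    using card_apexes_add_card_color_class[OF that] P1[OF that] S1[OF that] inj[of y] by (simp add: card_image)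
  obtain v where v: "v \<in> V"
    using top_vertex_exists top_vertex_in_V by blast
  have "nbrs v \<noteq> {}" using degN[OF v] by auto
  then obtain y where y: "y \<in> nbrs v" by blast
  obtain z where z: "apexes v y = {z}" using P1[OF y] card_1_singletonE by blast
  then have zN: "z \<in> nbrs v" "z \<in> nbrs y" "y \<in> nbrs z" using P_eq[OF y] adj_sym by (auto simp: nbrs_def)
  have Pz: "apexes v z = {y}"
  proof -
    have "y \<in> apexes v z" using P_eq[OF zN(1)] y zN by simp
    then show ?thesis using P1[OF zN(1)] by (metis card_1_singletonE singletonD)
  qed
  let ?W = "V - insert v (nbrs v)"
  have vV: "insert v (nbrs v) \<subseteq> V" "v \<notin> nbrs v"
    using nbrs_subset v adj_irrefl by (auto simp: nbrs_def)
  have cW: "card ?W + card (nbrs v) + 1 = card V"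
    using vV finite_V card_mono[OF finite_V vV(1)] card_Diff_subset[OF _ vV(1)] by simp
  \<comment> \<open>Besides \<open>v\<close> and \<open>b\<close>, all neighbors of \<open>a\<close>
    lie in \<open>?W\<close>. There are at least (n - 3)/2 of them, and \<open>?W\<close> is no
    larger than that.\<close>
  have full: "?W \<subseteq> nbrs a" if a: "a \<in> nbrs v" "apexes v a = {b}" for a b
  proof -
    have sub: "nbrs a \<subseteq> insert v (insert b (nbrs a \<inter> ?W))"
      using P_eq[OF a(1)] a(2) nbrs_subset[of a] by auto
    have "card (nbrs a) \<le> card (insert v (insert b (nbrs a \<inter> ?W)))"
      using sub finite_V by (intro card_mono) auto
    also have "\<dots> \<le> card (nbrs a \<inter> ?W) + 2"
      using finite_V by (simp add: card_insert_if)
    finally have "card (nbrs a) \<le> card (nbrs a \<inter> ?W) + 2" .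
    moreover have "2 * card (nbrs a) \<ge> card V + 1" "2 * card (nbrs v) \<ge> card V + 1"
      using degN[of a] degN[OF v] nbrs_subset a by auto
    ultimately have "card ?W \<le> card (nbrs a \<inter> ?W)"
      using cW by linarith
    then have "nbrs a \<inter> ?W = ?W"
      using finite_V by (intro card_seteq) auto
    then show ?thesis by blast
  qed
  \<comment> \<open>\<open>deg_sum\<close> bounds the degree of \<open>v\<close> by (n + 1)/2, so
    \<open>?W\<close> has at least (n - 3)/2 elements, which is positive for n at least 5.\<close>
  have "card ?W > 0"
    using cW deg_sum[OF y] degN[OF v] degN[of y] y nbrs_subset[of v] assms(1) by auto
  then have "?W \<noteq> {}" by (metis card.empty less_irrefl)
  then obtain w where w: "w \<in> ?W" by blast
  have "w \<in> nbrs y" "w \<in> nbrs z"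
    using w full[OF y z] full[OF zN(1) Pz] by blast+
  moreover have "v \<in> nbrs y" "v \<in> nbrs z"
    using y zN(1) adj_sym by (simp_all add: nbrs_def)
  ultimately have "w \<in> apexes y z" "v \<in> apexes y z"
    using P_eq[OF zN(2)] by simp_all
  moreover obtain u where "apexes y z = {u}"
    using P1[OF zN(2)] card_1_singletonE by blast
  ultimately show False using w by auto
qed

theorem rainbow_book:
  assumes "5 \<le> card V"
  shows "\<exists>v y. 2 \<le> card (rainbow_apexes v y)"
proof (rule ccontr)
  assume "\<not> ?thesis"
  then have few: "card (rainbow_apexes v y) \<le> 1" for v y
    by (metis not_less_eq_eq numeral_2_eq_2 One_nat_def)
  have tight: "tight v (nbrs v)" if "top_vertex v" for v
  proof -
    have "card (apexes v y) \<le> card (bad_apexes v y \<inter> nbrs v) + 1" for y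
    proof -
      have "bad_apexes v y \<inter> nbrs v = bad_apexes v y" using apexes_subset by (auto simp: bad_apexes_def)
      then show ?thesis using card_apexes[of v y] few[of v y] by simp
    qed
    then show ?thesis using that by (simp add: tight_def)
  qed
  have m: "2 \<le> m"
    using proper_case[OF assms few] by (cases "m \<le> 1") auto
  obtain v where v: "top_vertex v" using top_vertex_exists by blast
  then obtain z where z: "z \<in> nbrs v" "card (color_class v z) = m" by (auto simp: top_vertex_def)
  then have "z \<in> nbrs v - solo_nbrs v" using m by (auto simp: solo_nbrs_def)
  then have sub: "nbrs v - color_class v z \<subseteq> solo_nbrs v" using tight_multi[OF tight[OF v]] by blast
  \<comment> \<open>Otherwise \<open>v\<close> would see a single color.\<close>
  have "\<not> nbrs v \<subseteq> color_class v z \<union> {}"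
    using color_class_cover[OF top_vertex_in_V[OF v], of z "{}"] assms by auto
  then obtain x where x: "x \<in> solo_nbrs v \<inter> nbrs v" using sub by auto
  have "\<not> color_class x v \<subseteq> {v}"
    using tight_single(1)[OF tight[OF v] x] m card_mono[of "{v}" "color_class x v"] by auto
  then obtain y where y: "y \<in> color_class x v - {v}" by blast
  have yB: "y \<in> solo_nbrs v \<inter> nbrs v" using tight_single(2)[OF tight[OF v] x] y by blast
  \<comment> \<open>The leaf \<open>y\<close> is itself a solo neighbor of \<open>v\<close>, so it
    can take the role of \<open>x\<close> in \<open>tight_single\<close>.\<close>
  have "top_vertex y" using tight_single(3)[OF tight[OF v] yB] .
  moreover have "x \<in> nbrs y" using y adj_sym by (auto simp: color_class_def nbrs_def)
  ultimately show False
    using tight_no_return[OF tight[OF v] tight x y] by blast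
qed

section \<open>Two rainbow triangles sharing only a vertex\<close>

lemma rainbow_apexes_distinct: "x \<in> rainbow_apexes v y \<Longrightarrow> x \<noteq> y \<and> x \<noteq> v \<and> y \<noteq> v \<and> x \<in> nbrs v \<and> y \<in> nbrs v"
  using adj_irrefl by (auto simp: rainbow_apexes_def apexes_def nbrs_def)

text \<open>Every neighbor has an apex and solo ones have \<open>m - 1\<close> more. The bad apexes
  account for at most this surplus. The sum is the degree sum of the graph that the rainbow
  triangles at \<open>v\<close> induce on its neighbors.\<close>

lemma card_nbrs_le_sum_card_rainbow_apexes:
  assumes "top_vertex v"
  shows "card (nbrs v) \<le> (\<Sum>y\<in>nbrs v. card (rainbow_apexes v y))"
proof -
  let ?g = "\<lambda>y. if y \<in> solo_nbrs v then m - 1 else 0"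
  have BN: "solo_nbrs v \<subseteq> nbrs v" by (auto simp: solo_nbrs_def)
  have "1 + ?g y \<le> card (apexes v y)" if "y \<in> nbrs v" for y
    using card_apexes_pos[OF that] card_apexes_ge_top[OF assms, of y] by auto
  then have "(\<Sum>y\<in>nbrs v. 1 + ?g y) \<le> (\<Sum>y\<in>nbrs v. card (apexes v y))"
    by (intro sum_mono) auto
  moreover have "(\<Sum>y\<in>nbrs v. 1 + ?g y) = card (nbrs v) + card (solo_nbrs v) * (m - 1)"
    using BN by (simp only: sum.distrib) (simp add: sum.If_cases Int_absorb1)
  moreover have "bad_apexes v y \<inter> nbrs v = bad_apexes v y" for y
    using apexes_subset by (auto simp: bad_apexes_def)
  then have "(\<Sum>y\<in>nbrs v. card (bad_apexes v y)) \<le> card (solo_nbrs v) * (m - 1)"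
    using sum_card_bad_apexes_le[of "nbrs v" v] BN by (simp add: Int_absorb2)
  moreover have "(\<Sum>y\<in>nbrs v. card (apexes v y)) = (\<Sum>y\<in>nbrs v. card (bad_apexes v y)) + (\<Sum>y\<in>nbrs v. card (rainbow_apexes v y))"
    by (simp add: card_apexes sum.distrib)
  ultimately show ?thesis by linarith
qed

theorem rainbow_bowtie:
  assumes "13 \<le> card V"
  shows "\<exists>v x y x' y'. x \<in> rainbow_apexes v y \<and> x' \<in> rainbow_apexes v y' \<and> {x, y} \<inter> {x', y'} = {}"
proof (rule ccontr)
  assume "\<not> ?thesis"
  then have inter: "{x, y} \<inter> {x', y'} \<noteq> {}" if "x \<in> rainbow_apexes v y" "x' \<in> rainbow_apexes v y'" for v x y x' y'
    using that by blast
  \<comment> \<open>In the graph of rainbow triangles at \<open>v\<close>, a vertex \<open>w\<close>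
    of degree 3 has a neighbor outside any edge \<open>xy\<close> that misses \<open>w\<close>,
    which would give disjoint edges.\<close>
  have star: "x = w" if "3 \<le> card (rainbow_apexes v w)" "x \<in> rainbow_apexes v y" "y \<noteq> w" for v w x y
  proof (rule ccontr)
    assume "x \<noteq> w"
    have "card {x, y} \<le> 2" by (simp add: card_insert_if)
    then have "\<not> rainbow_apexes v w \<subseteq> {x, y}"
      using that(1) card_mono[of "{x, y}" "rainbow_apexes v w"] by auto
    then obtain u where "u \<in> rainbow_apexes v w" "u \<notin> {x, y}" by blast
    then show False
      using inter[of u v w x y] that \<open>x \<noteq> w\<close> by auto
  qed
  have star_le: "card (rainbow_apexes v y) \<le> 1" if "3 \<le> card (rainbow_apexes v w)" "y \<noteq> w" for v w y
  proof -
    have "rainbow_apexes v y \<subseteq> {w}" using star that by blast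
    then show ?thesis using card_mono[of "{w}" "rainbow_apexes v y"] by simp
  qed
  \<comment> \<open>If all degrees were at most 2, at most three vertices would have positive
    degree. The degree sum would be at most 6, but n at least 13 forces at least 7.\<close>
  have center: "\<exists>w. 3 \<le> card (rainbow_apexes v w)" if v: "top_vertex v" for v
  proof (rule ccontr)
    assume "\<not> ?thesis"
    then have le2: "card (rainbow_apexes v y) \<le> 2" for y
      by (metis not_less_eq_eq numeral_2_eq_2 numeral_3_eq_3)
    have "card (col v ` nbrs v) \<le> card (nbrs v)"
      by (simp add: card_image_le)
    then have "14 \<le> 2 * card (nbrs v)"
      using color_deg_nbrs[OF top_vertex_in_V[OF v]] assms by linarith
    then have sum7: "7 \<le> (\<Sum>y\<in>nbrs v. card (rainbow_apexes v y))"
      using card_nbrs_le_sum_card_rainbow_apexes[OF v] by linarith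
    then have "\<exists>a. rainbow_apexes v a \<noteq> {}"
      by (metis card.empty not_numeral_le_zero sum.neutral)
    then obtain a b where ab: "b \<in> rainbow_apexes v a" by blast
    let ?X = "{y \<in> nbrs v. rainbow_apexes v y \<noteq> {}}"
    \<comment> \<open>Two vertices outside the edge \<open>ab\<close> would be joined to the same
      end \<open>p\<close> of it. With the other end of \<open>ab\<close>, \<open>p\<close> would
      have degree 3.\<close>
    have one: "y = y'" if y: "y \<in> ?X - {a, b}" "y' \<in> ?X - {a, b}" for y y'
    proof (rule ccontr)
      assume "y \<noteq> y'"
      obtain p p' where p: "p \<in> rainbow_apexes v y" "p' \<in> rainbow_apexes v y'" using y by blast
      have "p \<in> {a, b}" "p' \<in> {a, b}"
        using inter[OF p(1) ab] inter[OF p(2) ab] y by blast+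
      then have "p = p'"
        using inter[OF p] y \<open>y \<noteq> y'\<close> by auto
      obtain z where z: "z \<in> rainbow_apexes v p" "z \<in> {a, b}"
        using ab rainbow_apexes_rotate \<open>p \<in> {a, b}\<close> by blast
      have "{z, y, y'} \<subseteq> rainbow_apexes v p"
        using z p rainbow_apexes_rotate \<open>p = p'\<close> by blast
      moreover have "card {z, y, y'} = 3"
        using z y \<open>y \<noteq> y'\<close> by auto
      ultimately have "3 \<le> card (rainbow_apexes v p)"
        using card_mono[of "rainbow_apexes v p" "{z, y, y'}"] by simp
      then show False using le2[of p] by simp
    qed
    have "card (?X - {a, b}) \<le> 1"
      unfolding One_nat_def by (subst card_le_Suc0_iff_eq) (simp, use one in blast)
    moreover have "card ?X \<le> card ({a, b} \<union> (?X - {a, b}))"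
      by (intro card_mono) auto
    moreover have "card ({a, b} \<union> (?X - {a, b})) \<le> card {a, b} + card (?X - {a, b})"
      by (rule card_Un_le)
    moreover have "card {a, b} \<le> 2" by (simp add: card_insert_if)
    ultimately have X3: "card ?X \<le> 3" by linarith
    have "(\<Sum>y\<in>nbrs v. card (rainbow_apexes v y)) = (\<Sum>y\<in>?X. card (rainbow_apexes v y))"
      by (intro sum.mono_neutral_right) auto
    also have "\<dots> \<le> card ?X * 2"
      using sum_bounded_above[of ?X "\<lambda>y. card (rainbow_apexes v y)" 2] le2 by simp
    finally show False using X3 sum7 by linarith
  qed
  have tight: "tight v (nbrs v - {w})" if "top_vertex v" "3 \<le> card (rainbow_apexes v w)" for v w
  proof -
    have "card (apexes v y) \<le> card (bad_apexes v y \<inter> (nbrs v - {w})) + 1" if "y \<in> nbrs v - {w}" for y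
    proof -
      have "rainbow_apexes v y \<subseteq> {w}"
        using star \<open>3 \<le> card (rainbow_apexes v w)\<close> that by blast
      then have "apexes v y \<subseteq> insert w (bad_apexes v y \<inter> (nbrs v - {w}))"
        using apexes_subset by (auto simp: bad_apexes_def rainbow_apexes_def)
      then have "card (apexes v y) \<le> card (insert w (bad_apexes v y \<inter> (nbrs v - {w})))"
        by (intro card_mono) auto
      then show ?thesis by (simp add: card_insert_if)
    qed
    then show ?thesis using that by (simp add: tight_def)
  qed
  obtain v where v: "top_vertex v" using top_vertex_exists by blast
  obtain w where w: "3 \<le> card (rainbow_apexes v w)" using center[OF v] by blast
  let ?Y = "nbrs v - {w}"
  have tv: "tight v ?Y" using tight[OF v w] .
  \<comment> \<open>A center at \<open>x\<close> would lie on the edge \<open>vw\<close> of the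
    triangle \<open>xvw\<close>. But \<open>vw\<close> is the heavy edge both at \<open>v\<close>
    and at \<open>w\<close>, so \<open>xv\<close> and \<open>xw\<close> have at most one rainbow
    apex each.\<close>
  have not_top: "\<not> top_vertex x" if x: "x \<in> rainbow_apexes v w" for x
  proof
    assume "top_vertex x"
    then obtain w' where w': "3 \<le> card (rainbow_apexes x w')" using center by blast
    have dist: "x \<noteq> w" "x \<noteq> v" using rainbow_apexes_distinct[OF x] by auto
    have "w \<in> rainbow_apexes x v" using x rainbow_apexes_rotate rainbow_apexes_commute by blast
    then have "w' = v \<or> w' = w" using star[OF w'] by blast
    moreover have "card (rainbow_apexes x v) \<le> 1"
      using star_le[OF w dist(1)] by (simp add: rainbow_apexes_commute)
    moreover have "card (rainbow_apexes x w) \<le> 1"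
      using star_le[of w v x] w dist(2) rainbow_apexes_commute by metis
    ultimately show False using w' by auto
  qed
  have DB: "rainbow_apexes v w \<subseteq> ?Y - solo_nbrs v"
  proof
    fix x assume x: "x \<in> rainbow_apexes v w"
    then have "x \<in> ?Y" using rainbow_apexes_distinct by blast
    then show "x \<in> ?Y - solo_nbrs v"
      using tight_single(3)[OF tv, of x] not_top[OF x] by blast
  qed
  have "rainbow_apexes v w \<noteq> {}" using w by auto
  then obtain x1 where x1: "x1 \<in> rainbow_apexes v w" by blast
  \<comment> \<open>No rainbow apex of \<open>vw\<close> is solo, so all of them share the color
    class of \<open>x1\<close>. This forces \<open>m\<close> to be at least 3.\<close>
  have sub: "nbrs v - color_class v x1 \<subseteq> solo_nbrs v"
    using tight_multi[OF tv] DB x1 by blast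
  then have "rainbow_apexes v w \<subseteq> color_class v x1" using DB by blast
  then have "card (rainbow_apexes v w) \<le> card (color_class v x1)"
    by (intro card_mono) auto
  also have "\<dots> \<le> m"
    using card_color_class_le rainbow_apexes_distinct[OF x1] by simp
  finally have m: "3 \<le> m" using w by simp
  have "\<not> nbrs v \<subseteq> color_class v x1 \<union> {w}"
    using color_class_cover[OF top_vertex_in_V[OF v], of x1 "{w}"] assms by auto
  then obtain x where x: "x \<in> solo_nbrs v \<inter> ?Y" using sub by auto
  \<comment> \<open>\<open>y\<close> is again a top vertex, tight after omitting its center. By
    \<open>tight_no_return\<close> the omitted vertex must be \<open>x\<close>. Two such leaves
    \<open>y\<close> then contradict \<open>star_le\<close> at \<open>x\<close>.\<close>
  have D_large: "3 \<le> card (rainbow_apexes x y)" if y: "y \<in> color_class x v - {v}" for y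
  proof -
    have "y \<in> solo_nbrs v \<inter> ?Y" using tight_single(2)[OF tv x] y by blast
    then have ty: "top_vertex y" using tight_single(3)[OF tv] by blast
    then obtain w' where w': "3 \<le> card (rainbow_apexes y w')" using center by blast
    have "x \<in> nbrs y" using y adj_sym by (auto simp: color_class_def nbrs_def)
    then have "x = w'"
      using tight_no_return[OF tv tight[OF ty w'] x y] by blast
    then show ?thesis using w' rainbow_apexes_commute by metis
  qed
  have "v \<in> color_class x v" using x adj_sym self_in_color_class by (auto simp: solo_nbrs_def nbrs_def)
  then have c2: "2 \<le> card (color_class x v - {v})"
    using m tight_single(1)[OF tv x] by simp
  then have "color_class x v - {v} \<noteq> {}" by (metis card.empty not_numeral_le_zero)
  then obtain y1 where y1: "y1 \<in> color_class x v - {v}" by blast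
  have "\<not> color_class x v - {v} \<subseteq> {y1}"
    using c2 card_mono[of "{y1}" "color_class x v - {v}"] by auto
  then obtain y2 where y2: "y2 \<in> color_class x v - {v}" "y2 \<noteq> y1" by blast
  show False
    using star_le[OF D_large[OF y1] y2(2)] D_large[OF y2(1)] by simp
qed

end

section \<open>Reduction of edge-colored graphs to star-colored ones\<close>

lemma nsets_2_triple:
  assumes "a \<noteq> b" "a \<noteq> d" "b \<noteq> d"
  shows "[{a, b, d}]\<^bsup>2\<^esup> = {{a, b}, {a, d}, {b, d}}"
  using assms by (auto simp: nsets_2_eq)

lemma rainbow_triangleI:
  assumes "E \<subseteq> [V]\<^bsup>2\<^esup>" "{a, b} \<in> E" "{a, d} \<in> E" "{b, d} \<in> E"
    and "c {a, b} \<noteq> c {a, d}" "c {a, b} \<noteq> c {b, d}" "c {a, d} \<noteq> c {b, d}"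
  shows "rainbow_triangle V E c {a, b, d}"
proof -
  have "{a, b} \<in> [V]\<^bsup>2\<^esup>" "{a, d} \<in> [V]\<^bsup>2\<^esup>" "{b, d} \<in> [V]\<^bsup>2\<^esup>"
    using assms by blast+
  then have "a \<noteq> b" "a \<noteq> d" "b \<noteq> d" "{a, b, d} \<subseteq> V" by auto
  with assms show ?thesis
    by (auto simp: rainbow_triangle_def triangle_def rainbow_def nsets_2_triple)
      (auto simp: nsets_def)
qed

lemma color_degree_eq:
  assumes "F \<subseteq> [V]\<^bsup>2\<^esup>"
  shows "color_degree F c v = card ((\<lambda>u. c {v, u}) ` {u. {v, u} \<in> F})"
proof -
  have "{e \<in> F. v \<in> e} = (\<lambda>u. {v, u}) ` {u. {v, u} \<in> F}"
  proof (intro equalityI subsetI)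
    fix e assume e: "e \<in> {e \<in> F. v \<in> e}"
    then have "e \<in> [V]\<^bsup>2\<^esup>" using assms by blast
    then obtain x y where "e = {x, y}" by (rule nsets2_E)
    with e show "e \<in> (\<lambda>u. {v, u}) ` {u. {v, u} \<in> F}"
      by (auto simp: insert_commute)
  qed auto
  then show ?thesis
    by (simp add: color_degree_def image_image)
qed

text \<open>\<open>F\<close> has the fewest edges among the subsets of \<open>E\<close> that keep
  the degree condition. An edge whose color recurs at both of its ends could be deleted without
  losing a color at any vertex.\<close>

lemma minimal_star_subgraph:
  assumes "simple_graph V E" "V \<noteq> {}"
    and deg: "\<And>v. v \<in> V \<Longrightarrow> card V + 1 \<le> 2 * color_degree E c v"
  obtains F m where "F \<subseteq> E"
    "star_colored_graph V (\<lambda>u v. {u, v} \<in> F) (\<lambda>u v. c {u, v}) m"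
proof -
  have fin: "finite V" and E: "E \<subseteq> [V]\<^bsup>2\<^esup>"
    using assms by (auto simp: simple_graph_def)
  have finE: "finite E"
    using E fin finite_imp_finite_nsets finite_subset by blast
  let ?good = "\<lambda>F. F \<subseteq> E \<and> (\<forall>v\<in>V. card V + 1 \<le> 2 * color_degree F c v)"
  have "?good E" using deg by auto
  then obtain F where F: "?good F" and min: "\<And>G. ?good G \<Longrightarrow> card F \<le> card G"
    using ex_has_least_nat[of ?good E card] by blast
  have FV: "F \<subseteq> [V]\<^bsup>2\<^esup>" and finF: "finite F"
    using F E finE finite_subset by auto
  have inV: "u \<in> V \<and> v \<in> V \<and> u \<noteq> v" if "{u, v} \<in> F" for u v
  proof -
    have "{u, v} \<in> [V]\<^bsup>2\<^esup>" using FV that by blast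
    then show ?thesis by simp
  qed
  have finN: "finite {u. {v, u} \<in> F \<and> R u}" for v R
    by (rule finite_subset[OF _ fin]) (use inV in auto)
  have stars: "c {v, b} \<noteq> c {u, v}"
    if *: "{u, v} \<in> F" "{u, a} \<in> F" "a \<noteq> v" "c {u, a} = c {u, v}" "{v, b} \<in> F" "b \<noteq> u" for u v a b
  proof
    assume c: "c {v, b} = c {u, v}"
    let ?G = "F - {{u, v}}"
    have "c ` {e \<in> ?G. x \<in> e} = c ` {e \<in> F. x \<in> e}" for x
    proof
      show "c ` {e \<in> F. x \<in> e} \<subseteq> c ` {e \<in> ?G. x \<in> e}"
      proof
        fix i assume "i \<in> c ` {e \<in> F. x \<in> e}"
        then obtain e where e: "e \<in> F" "x \<in> e" "i = c e" by blast
        show "i \<in> c ` {e \<in> ?G. x \<in> e}"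
        proof (cases "e = {u, v}")
          case False
          with e show ?thesis by blast
        next
          case True
          have "{u, a} \<in> ?G" "{v, b} \<in> ?G"
            using * by (auto simp: doubleton_eq_iff)
          moreover have "x = u \<or> x = v" using e True by auto
          ultimately show ?thesis
            using e True *(4) c by (metis (mono_tags, lifting) image_eqI insertI1 mem_Collect_eq)
        qed
      qed
    qed auto
    then have "?good ?G"
      using F by (auto simp: color_degree_def)
    then show False
      using min[of ?G] card_Diff1_less[OF finF *(1)] by auto
  qed
  let ?mono = "\<lambda>(v, y). card {u. {v, u} \<in> F \<and> c {v, u} = c {v, y}}"
  let ?pairs = "{(v, y). {v, y} \<in> F}"
  have "?pairs \<subseteq> V \<times> V" using inV by auto
  then have fin_pairs: "finite ?pairs"
    using fin finite_subset by blast
  obtain v where v: "v \<in> V" using assms by blast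
  \<comment> \<open>A positive color degree yields an edge, so the maximum \<open>?m\<close> is
    taken over a nonempty set.\<close>
  then have "color_degree F c v \<noteq> 0" using F by fastforce
  then have "{u. {v, u} \<in> F} \<noteq> {}"
    using color_degree_eq[OF FV, of c v] by (metis card.empty image_empty)
  then have ne: "?pairs \<noteq> {}" by auto
  let ?m = "Max (?mono ` ?pairs)"
  have "?m \<in> ?mono ` ?pairs"
    using fin_pairs ne by (intro Max_in) auto
  then obtain p where "p \<in> ?pairs" "?m = ?mono p" by blast
  then have attained: "\<exists>v y. {v, y} \<in> F \<and> card {u. {v, u} \<in> F \<and> c {v, u} = c {v, y}} = ?m"
    by (cases p) fastforce
  have le: "card {u. {v, u} \<in> F \<and> c {v, u} = c {v, y}} \<le> ?m" if "{v, y} \<in> F" for v y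
  proof -
    have "?mono (v, y) \<in> ?mono ` ?pairs" using that by blast
    then have "?mono (v, y) \<le> ?m" using fin_pairs by (intro Max_ge) auto
    then show ?thesis by simp
  qed
  have "star_colored_graph V (\<lambda>u v. {u, v} \<in> F) (\<lambda>u v. c {u, v}) ?m"
  proof
    show "card V + 1 \<le> 2 * card ((\<lambda>u. c {v, u}) ` Collect (\<lambda>u. {v, u} \<in> F))" if "v \<in> V" for v
      using F that unfolding color_degree_eq[OF FV] by blast
    show "finite V" by (rule fin)
    show "u \<in> V" if "{u, v} \<in> F" for u v using inV[OF that] by simp
    show "{u, u} \<notin> F" for u using inV[of u u] by blast
    show "{v, u} \<in> F" if "{u, v} \<in> F" for u v using that by (simp add: insert_commute)
    show "c {u, v} = c {v, u}" for u v by (simp add: insert_commute)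
  qed (fact stars le attained)+
  with F show ?thesis using that by blast
qed

theorem theorem2:
  fixes V :: "'a set" and E :: "'a set set" and c :: "'a set \<Rightarrow> nat" and n :: nat
  assumes "simple_graph V E"
    and "card V = n"
    and "real (min_color_degree V E c) \<ge> (real n + 1) / 2"
  shows "(n \<ge> 5 \<longrightarrow>
            (\<exists>T1 T2 e. rainbow_triangle V E c T1 \<and> rainbow_triangle V E c T2 \<and>
               [T1]\<^bsup>2\<^esup> \<inter> [T2]\<^bsup>2\<^esup> = {e})) \<and>
         (n \<ge> 13 \<longrightarrow>
            (\<exists>T1 T2 v. rainbow_triangle V E c T1 \<and> rainbow_triangle V E c T2 \<and>
               T1 \<inter> T2 = {v}))"
proof (cases "5 \<le> n")
  case True
  have fin: "finite V" and E: "E \<subseteq> [V]\<^bsup>2\<^esup>"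
    using assms by (auto simp: simple_graph_def)
  have "V \<noteq> {}" using True assms(2) by auto
  have deg: "card V + 1 \<le> 2 * color_degree E c v" if "v \<in> V" for v
  proof -
    have "min_color_degree V E c \<le> color_degree E c v"
      using that fin by (simp add: min_color_degree_def)
    then have "real (card V + 1) \<le> real (2 * color_degree E c v)"
      using assms(2,3) by (simp add: field_simps)
    then show ?thesis by (simp only: of_nat_le_iff)
  qed
  obtain F m where F: "F \<subseteq> E"
    and "star_colored_graph V (\<lambda>u v. {u, v} \<in> F) (\<lambda>u v. c {u, v}) m"
    using minimal_star_subgraph[OF assms(1) \<open>V \<noteq> {}\<close> deg] by blast
  then interpret star_colored_graph V "\<lambda>u v. {u, v} \<in> F" "\<lambda>u v. c {u, v}" m
    by simp
  \<comment> \<open>Deleting edges changed no colors, so rainbow triangles of \<open>F\<close> are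
    rainbow triangles of \<open>E\<close>.\<close>
  have tri: "rainbow_triangle V E c {v, y, x}" if "x \<in> rainbow_apexes v y" for v y x
    using that F by (intro rainbow_triangleI[OF E]) (auto simp: rainbow_apexes_def apexes_def)
  have "\<exists>T1 T2 e. rainbow_triangle V E c T1 \<and> rainbow_triangle V E c T2 \<and>
      [T1]\<^bsup>2\<^esup> \<inter> [T2]\<^bsup>2\<^esup> = {e}"
  proof -
    obtain v y where "2 \<le> card (rainbow_apexes v y)"
      using rainbow_book True assms(2) by blast
    then have "\<not> card (rainbow_apexes v y) \<le> Suc 0" by simp
    then obtain x x' where x: "x \<in> rainbow_apexes v y" "x' \<in> rainbow_apexes v y" "x \<noteq> x'"
      by (auto simp: card_le_Suc0_iff_eq)
    have "v \<noteq> y" "x \<noteq> v" "x \<noteq> y" "x' \<noteq> v" "x' \<noteq> y"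
      using rainbow_apexes_distinct[OF x(1)] rainbow_apexes_distinct[OF x(2)] by auto
    then have "[{v, y, x}]\<^bsup>2\<^esup> \<inter> [{v, y, x'}]\<^bsup>2\<^esup> = {{v, y}}"
      using x(3) by (auto simp: nsets_2_triple doubleton_eq_iff)
    then show ?thesis using tri x by blast
  qed
  moreover have "\<exists>T1 T2 v. rainbow_triangle V E c T1 \<and> rainbow_triangle V E c T2 \<and> T1 \<inter> T2 = {v}"
    if "13 \<le> n"
  proof -
    obtain v x y x' y' where x: "x \<in> rainbow_apexes v y" "x' \<in> rainbow_apexes v y'" "{x, y} \<inter> {x', y'} = {}"
      using rainbow_bowtie \<open>13 \<le> n\<close> assms(2) by blast
    then have "{v, y, x} \<inter> {v, y', x'} = {v}"
      using rainbow_apexes_distinct[OF x(1)] rainbow_apexes_distinct[OF x(2)] by auto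
    then show ?thesis using tri x by blast
  qed
  ultimately show ?thesis by blast
qed simp

end
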